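(* Assume $\delta>0$. Let $r_J\ge0$ be fixed and let $\hat m\in\hat{\mathcal M}_1(r_J)\cap\bigcap_{r\ge0}\hat{\mathcal M}_2(r)$. Suppose that the rate $r_I\ge0$ satisfies $$(1+r_I)(D+\hat a_2(r_I))\ge f^{-1}\Big[B(\hat m)\,e^{-u\delta\psi(\hat a_2(r_I))}\big(e^{u(1+r_J)(D+\hat a_2(r_I))}-1\big)\Big]$$ and at least one of the following two conditions: $$(1+r_I)f'\big[(1+r_I)(D+\hat a_1(r_J))\big]>(b^a)'(\hat a_1(r_J))+u\delta\,\psi'(\hat a_1(r_J))\,B(\hat m)\,e^{-u\delta\psi(\hat a_1(r_J))},$$ $$\text{or}\qquad \psi'(\hat a_2(r_I))>\frac{(u+v)(1+r_J)}{u\delta}.$$ Then $\hat I^1(\hat m)\ge\hat I^2(\hat m)$, i.e. the better contract for firm $I$ is the first one (outsourcing).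
   Context: Standing assumptions. $u,v>0$; $D>0$, $r_I,r_J\ge 0$, $\delta\in\mathbb R$, $x^+=\max(x,0)$. $\mu$ is a non-constant real random variable bounded from below by a finite constant $\underline\mu$, with $\mathbb E[e^{\lambda\mu}]<\infty$ for all $\lambda\in\mathbb R$. $\varphi,\psi:\mathbb R_+\to\mathbb R_+$ are $C^1$, increasing, strictly concave, $\varphi'(0)=\psi'(0)=+\infty$, $\varphi'(\infty)=\psi'(\infty)=0$, $\varphi(\infty)+\delta^+\psi(\infty)<\underline\mu$, and $(\varphi')^{-1}(x)\sim(\psi')^{-1}(x)$ as $x\to0$. $g:\mathbb R_+\to\mathbb R$ is $C^1$, increasing, strictly concave, $g'(0)=\infty$, $g'(\infty)=0$, and $m_0:=\inf\{m>0:g(m)>0\}<\infty$. $b^a,b^m,b^e:\mathbb R_+\to\mathbb R_+$ are $C^1$, increasing, concave; $(b^a)'(0)>0$ (possibly infinite), $(b^a)'(\infty)=0$, $b^a(\infty)<\infty$; $(b^m)'(0)=(b^e)'(0)=\infty$, $(b^m)'(\infty)=(b^e)'(\infty)=0$. $f:\mathbb R_+\to\mathbb R$ is differentiable, increasing, strictly convex, $f'(\infty)=\infty$; $f^{-1}$ is its inverse (the condition in the claim presupposes that its argument lies in the range of $f$). For $r\ge0$, $F_r(a)=b^a(a)-f((1+r)(D+a))$; it is assumed that $F_{r_I}'(0)>0$ (possibly infinite). Convention: $g(0)/g'(0)=0$. Notation. $e^*(\beta)=(\varphi')^{-1}\big(\frac1{(1-\beta)^+}\big)$ (equal to $0$ for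 $\beta\ge1$); $C(\beta)=\frac1v\ln\mathbb E\big[e^{v(1-\beta)(\mu-\varphi(e^*(\beta)))}\big]$; $G(m)=\frac{g(m)}{g'(m)}-m$, and $G^{-1}:[-m_0,\infty)\to[m_0,\infty)$ is the inverse of the increasing bijection $G|_{[m_0,\infty)}$; $\hat\beta=\frac v{u+v}$, $\hat e=e^*(\hat\beta)=(\varphi')^{-1}(\frac{u+v}u)$; with $\mathrm{Id}$ the identity map, $B(m)=e^{u(\mathrm{Id}-b^m)(m)}\,e^{u(\mathrm{Id}-b^e)(\hat e)}\,e^{(u+v)C(\hat\beta)}$. Situation 1 (outsourcing of debt and exploitation): the Nash equilibria are parametrized by the maintenance effort $\hat m$ in $$\hat{\mathcal M}_1(r_J)=\Big[0,G^{-1}\Big(C(\hat\beta)+(1+r_J)(D+\hat a_1(r_J))+\hat e-\tfrac u{u+v}\delta\psi(\hat a_1(r_J))\Big)\Big],\quad \hat a_1(r_J)=(\psi')^{-1}\Big(\frac{(u+v)(1+r_J)}{\delta u}\Big),$$ and the corresponding optimal value for firm $I$ is $$\hat I^1(\hat m)=b^a(\hat a_1(r_J))-e^{-u\delta\psi(\hat a_1(r_J))}e^{u(1+r_J)(D+\hat a_1(r_J))}B(\hat m).$$ Situation 2 (firm $I$ issues the debt, exploitation is outsourced): $\hat{\mathcal M}_2(r)$ is the set of $\hat m\ge0$ that are the maintenance effort of some Nash equilibrium in Situation 2 with interest rate $r$ for firm $I$, i.e. for which there is $\hat a\in\arg\max_{a\ge0}[F_r(a)-e^{-u\delta\psi(a)}B(\hat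 m)]$ with $C(\hat\beta)+\hat e-\frac u{u+v}\delta\psi(\hat a)-G(\hat m)\ge0$. For $\delta>0$, $\hat a_2(r_I)$ denotes the value of the control $a$ in the Nash equilibrium of Situation 2 with $m=\hat m$ and rate $r_I$, i.e. the unique maximizer over $a\ge0$ of $F_{r_I}(a)-e^{-u\delta\psi(a)}B(\hat m)$, and the corresponding optimal value for firm $I$ is $\hat I^2(\hat m)=F_{r_I}(\hat a_2(r_I))-e^{-u\delta\psi(\hat a_2(r_I))}B(\hat m)$. *)

theory Defs
  imports "HOL-Probability.Probability" "HOL-Library.Landau_Symbols"
begin

text \<open>
  A function on the nonnegative reals is a total function on the reals of which only the values
  on \<open>{0..}\<close> matter.  Its derivative at \<open>0\<close> is one-sided and may be infinite, hence extended real;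
  at points \<open>x > 0\<close> the derivative is the usual \<^const>\<open>deriv\<close>.
\<close>

definition deriv_zero :: "(real \<Rightarrow> real) \<Rightarrow> ereal" where
  "deriv_zero h = Lim (at_right 0) (\<lambda>x. ereal ((h x - h 0) / x))"

definition value_infty :: "(real \<Rightarrow> real) \<Rightarrow> ereal" where
  "value_infty h = Lim at_top (\<lambda>x. ereal (h x))"

text \<open>
  Class \<open>C\<^sup>1\<close> on \<open>{0..}\<close>, where the derivative at \<open>0\<close> is allowed to be infinite: the derivative
  is continuous on \<open>{0..}\<close> as an extended-real-valued function.
\<close>

definition C1_halfline :: "(real \<Rightarrow> real) \<Rightarrow> bool" where
  "C1_halfline h \<longleftrightarrow>
     continuous_on {0..} h \<and>
     (\<forall>x>0. h differentiable (at x)) \<and>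
     continuous_on {0<..} (deriv h) \<and>
     (\<exists>L. ((\<lambda>x. ereal ((h x - h 0) / x)) \<longlongrightarrow> L) (at_right 0) \<and>
          ((\<lambda>x. ereal (deriv h x)) \<longlongrightarrow> L) (at_right 0))"

definition strictly_convex_on :: "real set \<Rightarrow> (real \<Rightarrow> real) \<Rightarrow> bool" where
  "strictly_convex_on S h \<longleftrightarrow>
     convex S \<and>
     (\<forall>x\<in>S. \<forall>y\<in>S. \<forall>t. x \<noteq> y \<and> 0 < t \<and> t < 1 \<longrightarrow>
        h ((1 - t) * x + t * y) < (1 - t) * h x + t * h y)"

definition strictly_concave_on :: "real set \<Rightarrow> (real \<Rightarrow> real) \<Rightarrow> bool" where
  "strictly_concave_on S h \<longleftrightarrow> strictly_convex_on S (\<lambda>x. - h x)"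

definition deriv_inv :: "(real \<Rightarrow> real) \<Rightarrow> real \<Rightarrow> real" where
  "deriv_inv h = the_inv_into {0<..} (deriv h)"

record 'w contract_data =
  base :: "'w measure"
  mu :: "'w \<Rightarrow> real"
  mu_low :: real
  par_u :: real
  par_v :: real
  debt :: real
  par_delta :: real
  phi :: "real \<Rightarrow> real"
  psi :: "real \<Rightarrow> real"
  gain :: "real \<Rightarrow> real"
  ben_a :: "real \<Rightarrow> real"
  ben_m :: "real \<Rightarrow> real"
  ben_e :: "real \<Rightarrow> real"
  cost_f :: "real \<Rightarrow> real"

text \<open>
  The fields \<open>debt\<close>, \<open>gain\<close>, \<open>ben_a\<close>, \<open>ben_m\<close>, \<open>ben_e\<close>, \<open>cost_f\<close> are $D$, $g$, $b^a$, $b^m$, $b^e$,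
  $f$; the random variable \<open>mu\<close> lives on the probability space \<open>base\<close>.
\<close>

definition mu_ok :: "'w contract_data \<Rightarrow> bool" where
  "mu_ok P \<longleftrightarrow>
     prob_space (base P) \<and>
     mu P \<in> borel_measurable (base P) \<and>
     \<not> (\<exists>c. AE w in base P. mu P w = c) \<and>
     (AE w in base P. mu_low P \<le> mu P w) \<and>
     (\<forall>l::real. integrable (base P) (\<lambda>w. exp (l * mu P w)))"

text \<open>
  The sum below is taken in the extended reals, where $0 \cdot \infty = 0$.
\<close>

definition phi_psi_ok :: "'w contract_data \<Rightarrow> bool" where
  "phi_psi_ok P \<longleftrightarrow>
     (\<forall>h\<in>{phi P, psi P}.
        (\<forall>x\<ge>0. 0 \<le> h x) \<and> C1_halfline h \<and> mono_on {0..} h \<and> strictly_concave_on {0..} h \<and>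
        deriv_zero h = \<infinity> \<and> (deriv h \<longlongrightarrow> 0) at_top) \<and>
     value_infty (phi P) + ereal (max (par_delta P) 0) * value_infty (psi P) < ereal (mu_low P) \<and>
     deriv_inv (phi P) \<sim>[at_right 0] deriv_inv (psi P)"

definition gain_ok :: "'w contract_data \<Rightarrow> bool" where
  "gain_ok P \<longleftrightarrow>
     C1_halfline (gain P) \<and> mono_on {0..} (gain P) \<and> strictly_concave_on {0..} (gain P) \<and>
     deriv_zero (gain P) = \<infinity> \<and> (deriv (gain P) \<longlongrightarrow> 0) at_top \<and>
     {m. 0 < m \<and> 0 < gain P m} \<noteq> {}"

definition benefits_ok :: "'w contract_data \<Rightarrow> bool" where
  "benefits_ok P \<longleftrightarrow>
     (\<forall>h\<in>{ben_a P, ben_m P, ben_e P}.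
        (\<forall>x\<ge>0. 0 \<le> h x) \<and> C1_halfline h \<and> mono_on {0..} h \<and> concave_on {0..} h \<and>
        (deriv h \<longlongrightarrow> 0) at_top) \<and>
     0 < deriv_zero (ben_a P) \<and> value_infty (ben_a P) < \<infinity> \<and>
     deriv_zero (ben_m P) = \<infinity> \<and> deriv_zero (ben_e P) = \<infinity>"

definition cost_ok :: "'w contract_data \<Rightarrow> bool" where
  "cost_ok P \<longleftrightarrow>
     cost_f P differentiable_on {0..} \<and> mono_on {0..} (cost_f P) \<and>
     strictly_convex_on {0..} (cost_f P) \<and> filterlim (deriv (cost_f P)) at_top at_top"

definition standing_assumptions :: "'w contract_data \<Rightarrow> bool" where
  "standing_assumptions P \<longleftrightarrow>
     0 < par_u P \<and> 0 < par_v P \<and> 0 < debt P \<and>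
     mu_ok P \<and> phi_psi_ok P \<and> gain_ok P \<and> benefits_ok P \<and> cost_ok P"

definition F :: "'w contract_data \<Rightarrow> real \<Rightarrow> real \<Rightarrow> real" where
  "F P r a = ben_a P a - cost_f P ((1 + r) * (debt P + a))"

definition e_star :: "'w contract_data \<Rightarrow> real \<Rightarrow> real" where
  "e_star P \<beta> = (if \<beta> \<ge> 1 then 0 else deriv_inv (phi P) (1 / max (1 - \<beta>) 0))"

definition C :: "'w contract_data \<Rightarrow> real \<Rightarrow> real" where
  "C P \<beta> = 1 / par_v P *
     ln (\<integral>w. exp (par_v P * (1 - \<beta>) * (mu P w - phi P (e_star P \<beta>))) \<partial>base P)"

definition m_zero :: "'w contract_data \<Rightarrow> real" where
  "m_zero P = Inf {m. 0 < m \<and> 0 < gain P m}"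

text \<open>The case distinction in \<open>G\<close> implements the convention $g(0)/g'(0) = 0$.\<close>

definition G :: "'w contract_data \<Rightarrow> real \<Rightarrow> real" where
  "G P m = (if m = 0 then 0 else gain P m / deriv (gain P) m) - m"

definition G_inv :: "'w contract_data \<Rightarrow> real \<Rightarrow> real" where
  "G_inv P = the_inv_into {m_zero P..} (G P)"

definition beta_hat :: "'w contract_data \<Rightarrow> real" where
  "beta_hat P = par_v P / (par_u P + par_v P)"

definition e_hat :: "'w contract_data \<Rightarrow> real" where
  "e_hat P = e_star P (beta_hat P)"

definition B :: "'w contract_data \<Rightarrow> real \<Rightarrow> real" where
  "B P m = exp (par_u P * (m - ben_m P m)) * exp (par_u P * (e_hat P - ben_e P (e_hat P)))
     * exp ((par_u P + par_v P) * C P (beta_hat P))"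

definition a_hat1 :: "'w contract_data \<Rightarrow> real \<Rightarrow> real" where
  "a_hat1 P r = deriv_inv (psi P) ((par_u P + par_v P) * (1 + r) / (par_delta P * par_u P))"

definition M_hat1 :: "'w contract_data \<Rightarrow> real \<Rightarrow> real set" where
  "M_hat1 P r =
     {0 .. G_inv P (C P (beta_hat P) + (1 + r) * (debt P + a_hat1 P r) + e_hat P
             - par_u P / (par_u P + par_v P) * par_delta P * psi P (a_hat1 P r))}"

definition I_hat1 :: "'w contract_data \<Rightarrow> real \<Rightarrow> real \<Rightarrow> real" where
  "I_hat1 P r m =
     ben_a P (a_hat1 P r)
     - exp (- par_u P * par_delta P * psi P (a_hat1 P r))
       * exp (par_u P * (1 + r) * (debt P + a_hat1 P r)) * B P m"

definition objective2 :: "'w contract_data \<Rightarrow> real \<Rightarrow> real \<Rightarrow> real \<Rightarrow> real" where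
  "objective2 P r m a = F P r a - exp (- par_u P * par_delta P * psi P a) * B P m"

definition M_hat2 :: "'w contract_data \<Rightarrow> real \<Rightarrow> real set" where
  "M_hat2 P r =
     {m. 0 \<le> m \<and> (\<exists>a. is_arg_max (objective2 P r m) (\<lambda>a. 0 \<le> a) a \<and>
        C P (beta_hat P) + e_hat P
          - par_u P / (par_u P + par_v P) * par_delta P * psi P a - G P m \<ge> 0)}"

text \<open>
  Under \<^const>\<open>standing_assumptions\<close> with $\delta > 0$ the objective is strictly concave on \<open>{0..}\<close>,
  so its maximizer is unique and \<^const>\<open>arg_max\<close> involves no choice.
\<close>

definition a_hat2 :: "'w contract_data \<Rightarrow> real \<Rightarrow> real \<Rightarrow> real" where
  "a_hat2 P r m = arg_max (objective2 P r m) (\<lambda>a. 0 \<le> a)"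

definition I_hat2 :: "'w contract_data \<Rightarrow> real \<Rightarrow> real \<Rightarrow> real" where
  "I_hat2 P r m = objective2 P r m (a_hat2 P r m)"

definition cost_inv :: "'w contract_data \<Rightarrow> real \<Rightarrow> real" where
  "cost_inv P = the_inv_into {0..} (cost_f P)"

end

theory Submission
  imports Defs
begin

text \<open>
  Consider the Situation 1 payoff \<open>b(a) - exp (h a) * B\<close> as a function of \<open>a\<close>, where
  \<open>h(a) = u (1 + r\<^sub>J) (D + a) - u \<delta> \<psi>(a)\<close>.  The condition on
  \<open>r\<^sub>I\<close> says that at \<open>a2\<close> this payoff exceeds the optimal value of Situation 2.  Either of the
  alternative conditions forces \<open>a2 \<le> a1\<close>: the first one by concavity of the objective, which has a
  negative slope at \<open>a1\<close>, the second one by monotonicity of \<open>\<psi>'\<close>.  Since \<open>a1\<close> lies to the left of the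
  minimizer of the convex function \<open>h\<close>, the Situation 1 payoff increases from \<open>a2\<close> to \<open>a1\<close>.
\<close>

section \<open>Tangent lines and strict convexity on the half-line\<close>

lemma convex_on_halfline_tangent:
  fixes h :: "real \<Rightarrow> real"
  assumes "convex_on {0..} h" and "0 < x" and "0 \<le> y" and "h differentiable (at x)"
  shows "h x + deriv h x * (y - x) \<le> h y"
proof -
  have "(h has_real_derivative deriv h x) (at x within {0..})"
    using assms(4) by (simp add: DERIV_deriv_iff_real_differentiable has_field_derivative_at_within)
  then have "h y - h x \<ge> deriv h x * (y - x)"
    using assms by (intro convex_on_imp_above_tangent[where A = "{0..}"]) auto
  then show ?thesis by simp
qed

lemma concave_on_halfline_tangent:
  fixes h :: "real \<Rightarrow> real"
  assumes "concave_on {0..} h" and "0 < x" and "0 \<le> y" and "h differentiable (at x)"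
  shows "h y \<le> h x + deriv h x * (y - x)"
proof -
  have "deriv (\<lambda>z. - h z) x = - deriv h x"
    using assms(4) by (intro DERIV_imp_deriv DERIV_minus) (simp add: DERIV_deriv_iff_real_differentiable)
  moreover have "- h x + deriv (\<lambda>z. - h z) x * (y - x) \<le> - h y"
    using assms by (intro convex_on_halfline_tangent) (auto simp: concave_on_def)
  ultimately show ?thesis by simp
qed

lemma strictly_convex_on_imp_convex_on:
  fixes h :: "real \<Rightarrow> real"
  assumes "strictly_convex_on S h"
  shows "convex_on S h"
proof (rule convex_onI)
  show "convex S" using assms by (simp add: strictly_convex_on_def)
  fix t x y :: real
  assume t: "0 < t" "t < 1" and xy: "x \<in> S" "y \<in> S"
  show "h ((1 - t) *\<^sub>R x + t *\<^sub>R y) \<le> (1 - t) * h x + t * h y"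
  proof (cases "x = y")
    case True
    then show ?thesis by (simp add: algebra_simps)
  next
    case False
    then show ?thesis using assms t xy by (force simp: strictly_convex_on_def)
  qed
qed

lemma strictly_concave_on_imp_concave_on:
  "strictly_concave_on S h \<Longrightarrow> concave_on S h"
  by (simp add: strictly_concave_on_def concave_on_def strictly_convex_on_imp_convex_on)

lemma strictly_convex_on_midpoint:
  assumes "strictly_convex_on S h" and "x \<in> S" and "y \<in> S" and "x \<noteq> y"
  shows "h ((x + y) / 2) < (h x + h y) / 2"
proof -
  have "h ((1 - 1 / 2) * x + 1 / 2 * y) < (1 - 1 / 2) * h x + 1 / 2 * h y"
    using assms unfolding strictly_convex_on_def
    by (elim conjE ballE[of S _ x] ballE[of S _ y] allE[of _ "1 / 2"]) auto
  moreover have "(1 - 1 / 2) * x + 1 / 2 * y = (x + y) / 2" by (simp add: field_simps)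
  ultimately show ?thesis by (simp add: field_simps)
qed

text \<open>\<open>mono_on\<close> is only weak monotonicity. If two points had equal values, strict
  convexity would push the value at their midpoint below the value at the left one. This makes
  \<open>cost_inv\<close> a genuine inverse on the range of the cost.\<close>

lemma mono_on_strictly_convex_on_imp_inj_on:
  assumes "mono_on S h" and "strictly_convex_on S h"
  shows "inj_on h S"
proof (rule linorder_inj_onI)
  fix x y
  assume xy: "x < y" "x \<in> S" "y \<in> S"
  have "(1 - 1 / 2) *\<^sub>R x + (1 / 2) *\<^sub>R y \<in> S"
    using assms(2) xy by (intro convexD_alt) (auto simp: strictly_convex_on_def)
  moreover have "(1 - 1 / 2) *\<^sub>R x + (1 / 2) *\<^sub>R y = (x + y) / 2" by (simp add: field_simps)
  ultimately have "(x + y) / 2 \<in> S" by metis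
  then have "h x \<le> h ((x + y) / 2)"
    using assms(1) xy by (intro mono_onD[OF assms(1)]) auto
  then show "h x \<noteq> h y"
    using strictly_convex_on_midpoint[OF assms(2), of x y] xy by auto
qed auto

text \<open>Both tangents, at \<open>x\<close> and at \<open>y\<close>, are evaluated at the
  midpoint. They bound \<open>h\<close> there from above, while strict concavity puts
  \<open>h\<close> there strictly above the mean of \<open>h x\<close> and \<open>h y\<close>;
  adding up separates the slopes.\<close>

lemma strictly_concave_on_deriv_strict_antimono:
  fixes h :: "real \<Rightarrow> real"
  assumes sc: "strictly_concave_on {0..} h" and diff: "\<And>x. 0 < x \<Longrightarrow> h differentiable (at x)"
    and "0 < x" and "x < y"
  shows "deriv h y < deriv h x"
proof -
  define z d where "z = (x + y) / 2" and "d = (y - x) / 2"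
  have z: "z - x = d" "z - y = - d" "0 \<le> z" "0 < d"
    using assms(3,4) by (auto simp: z_def d_def field_simps)
  note tan = concave_on_halfline_tangent[OF strictly_concave_on_imp_concave_on[OF sc] _ z(3) diff]
  have "h z \<le> h x + deriv h x * d"
    using tan[of x] assms(3) by (simp add: z)
  moreover have "h z \<le> h y - deriv h y * d"
    using tan[of y] assms(3,4) by (simp add: z)
  moreover have "(h x + h y) / 2 < h z"
    using strictly_convex_on_midpoint[of "{0..}" "\<lambda>x. - h x" x y] assms
    by (simp add: strictly_concave_on_def z_def field_simps)
  ultimately have "deriv h y * d < deriv h x * d" by (simp add: field_simps)
  then show ?thesis using z(4) by simp
qed

section \<open>Inverses of marginal functions and of the cost function\<close>

lemma deriv_tendsto_deriv_zero:
  assumes "C1_halfline h"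
  shows "((\<lambda>x. ereal (deriv h x)) \<longlongrightarrow> deriv_zero h) (at_right 0)"
proof -
  obtain L where L: "((\<lambda>x. ereal ((h x - h 0) / x)) \<longlongrightarrow> L) (at_right 0)"
    "((\<lambda>x. ereal (deriv h x)) \<longlongrightarrow> L) (at_right 0)"
    using assms by (auto simp: C1_halfline_def)
  have "deriv_zero h = L"
    unfolding deriv_zero_def using L(1) by (intro tendsto_Lim) auto
  then show ?thesis using L(2) by simp
qed

text \<open>Intermediate value theorem for the derivative, between a point near 0 where it exceeds
  \<open>c\<close> and a point further right where it is below \<open>c\<close>.\<close>

lemma deriv_attains_positive:
  assumes "C1_halfline h" and "deriv_zero h = \<infinity>" and lim: "(deriv h \<longlongrightarrow> 0) at_top" and "0 < c"
  obtains x where "0 < x" and "deriv h x = c"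
proof -
  have "((\<lambda>x. ereal (deriv h x)) \<longlongrightarrow> \<infinity>) (at_right 0)"
    using deriv_tendsto_deriv_zero[OF assms(1)] assms(2) by simp
  then have "eventually (\<lambda>x. c < deriv h x) (at_right 0)"
    by (auto simp: tendsto_PInfty)
  then have "eventually (\<lambda>x. c < deriv h x \<and> 0 < x) (at_right 0)"
    using eventually_at_right_less[of 0] by eventually_elim auto
  then obtain x where x: "c < deriv h x" "0 < x"
    using eventually_happens'[OF trivial_limit_at_right_real] by blast
  have "eventually (\<lambda>y. deriv h y < c) at_top"
    using order_tendstoD(2)[OF lim \<open>0 < c\<close>] .
  then have "eventually (\<lambda>y. deriv h y < c \<and> x \<le> y) at_top"
    using eventually_ge_at_top[of x] by eventually_elim auto
  then obtain y where y: "deriv h y < c" "x \<le> y"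
    using eventually_happens'[OF trivial_limit_at_top_linorder] by blast
  have "continuous_on {x..y} (deriv h)"
    using assms(1) x by (auto simp: C1_halfline_def intro: continuous_on_subset)
  then obtain z where "x \<le> z" "z \<le> y" "deriv h z = c"
    using IVT2'[of "deriv h" y c x] x y by auto
  then show thesis using x that[of z] by auto
qed

text \<open>\<open>the_inv_into\<close> is meaningful here because the derivative is injective on
  \<open>{0<..}\<close> (strictly decreasing) and takes the value \<open>c\<close>. For
  \<open>psi P\<close> this turns the formula for \<open>a_hat1\<close> into a first-order
  condition.\<close>

lemma deriv_inv_works:
  assumes "C1_halfline h" and "strictly_concave_on {0..} h"
    and "deriv_zero h = \<infinity>" and "(deriv h \<longlongrightarrow> 0) at_top" and "0 < c"
  shows "0 < deriv_inv h c" and "deriv h (deriv_inv h c) = c"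
proof -
  have inj: "inj_on (deriv h) {0<..}"
    using strictly_concave_on_deriv_strict_antimono[OF assms(2)] assms(1)
    by (intro linorder_inj_onI) (force simp: C1_halfline_def)+
  obtain x where x: "0 < x" "deriv h x = c"
    using deriv_attains_positive[OF assms(1,3-5)] .
  then have "deriv_inv h c = x"
    unfolding deriv_inv_def using inj by (intro the_inv_into_f_eq) auto
  with x show "0 < deriv_inv h c" and "deriv h (deriv_inv h c) = c" by auto
qed

lemma cost_inv_works:
  assumes "mono_on {0..} (cost_f P)" and "strictly_convex_on {0..} (cost_f P)"
    and "y \<in> cost_f P ` {0..}"
  shows "0 \<le> cost_inv P y" and "cost_f P (cost_inv P y) = y"
proof -
  note inj = mono_on_strictly_convex_on_imp_inj_on[OF assms(1,2)]
  show "0 \<le> cost_inv P y"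
    using the_inv_into_into[OF inj assms(3), of "{0..}"] by (simp add: cost_inv_def)
  show "cost_f P (cost_inv P y) = y"
    using f_the_inv_into_f[OF inj assms(3)] by (simp add: cost_inv_def)
qed

section \<open>Decrease of the Situation 2 objective\<close>

lemma exp_minus_tangent:
  fixes x y :: real
  shows "exp (- x) - exp (- x) * (y - x) \<le> exp (- y)"
proof -
  have "exp (- x) * (1 + (x - y)) \<le> exp (- x) * exp (x - y)"
    by (intro mult_left_mono exp_ge_add_one_self) auto
  also have "\<dots> = exp (- y)" by (simp flip: exp_add)
  finally show ?thesis by (simp add: algebra_simps)
qed

text \<open>Each of the three concave terms (benefit, negated cost, negated exponential) lies below
  its tangent at \<open>a\<close>. The slope condition says that these tangents together fall
  strictly to the right of \<open>a\<close>.\<close>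

lemma objective2_less_of_negative_slope:
  assumes st: "standing_assumptions P" and "0 < par_delta P" and "0 \<le> r" and a: "0 < a" "a < b"
    and slope: "deriv (ben_a P) a + par_u P * par_delta P * deriv (psi P) a * B P m
        * exp (- par_u P * par_delta P * psi P a)
      < (1 + r) * deriv (cost_f P) ((1 + r) * (debt P + a))"
  shows "objective2 P r m b < objective2 P r m a"
proof -
  let ?k = "par_u P * par_delta P" and ?D = "debt P"
  let ?x = "(1 + r) * (?D + a)" and ?y = "(1 + r) * (?D + b)"
  let ?E = "exp (- (?k * psi P a))"
  have pos: "0 < ?k" "0 < ?D" "0 < B P m"
    using st assms(2) by (auto simp: standing_assumptions_def B_def)
  have xy: "0 < ?x" "0 \<le> ?y" using pos assms by auto
  have ben: "ben_a P b \<le> ben_a P a + deriv (ben_a P) a * (b - a)"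
    using st a by (intro concave_on_halfline_tangent)
      (auto simp: standing_assumptions_def benefits_ok_def C1_halfline_def)
  have psi: "psi P b \<le> psi P a + deriv (psi P) a * (b - a)"
    using st a by (intro concave_on_halfline_tangent strictly_concave_on_imp_concave_on)
      (auto simp: standing_assumptions_def phi_psi_ok_def C1_halfline_def)
  have "cost_f P differentiable (at ?x within {0..})"
    using st xy by (auto simp: standing_assumptions_def cost_ok_def differentiable_on_def)
  \<comment> \<open>The cost is only assumed differentiable within \<open>{0..}\<close>;
    \<open>deriv\<close> needs the two-sided notion, available because \<open>?x\<close> is
    interior.\<close>
  moreover have "at ?x within {0..} = at ?x"
    using xy by (intro at_within_interior) auto
  ultimately have "cost_f P ?x + deriv (cost_f P) ?x * (?y - ?x) \<le> cost_f P ?y"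
    using st xy by (intro convex_on_halfline_tangent strictly_convex_on_imp_convex_on)
      (auto simp: standing_assumptions_def cost_ok_def)
  then have cost: "cost_f P ?x + (1 + r) * deriv (cost_f P) ?x * (b - a) \<le> cost_f P ?y"
    by (simp add: algebra_simps)
  \<comment> \<open>The tangent bound for \<open>psi P\<close> is inserted into the tangent of
    exp(-t) at t = \<open>?k * psi P a\<close>, giving an affine lower bound for the exponential at
    \<open>b\<close>.\<close>
  have "?k * (psi P b - psi P a) \<le> ?k * (deriv (psi P) a * (b - a))"
    using psi pos by (intro mult_left_mono) auto
  then have "?E * (?k * psi P b - ?k * psi P a) \<le> ?E * (?k * (deriv (psi P) a * (b - a)))"
    by (intro mult_left_mono) (auto simp: algebra_simps)
  then have "?E - ?E * (?k * (deriv (psi P) a * (b - a))) \<le> exp (- (?k * psi P b))"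
    using exp_minus_tangent[of "?k * psi P a" "?k * psi P b"] by linarith
  then have "(?E - ?E * (?k * (deriv (psi P) a * (b - a)))) * B P m \<le> exp (- (?k * psi P b)) * B P m"
    using pos by (intro mult_right_mono) auto
  moreover have "(deriv (ben_a P) a + ?k * deriv (psi P) a * B P m * ?E) * (b - a)
      < (1 + r) * deriv (cost_f P) ?x * (b - a)"
    using slope a by (intro mult_strict_right_mono) auto
  ultimately show ?thesis
    using ben cost by (simp add: objective2_def F_def algebra_simps)
qed

theorem theorem4:
  fixes P :: "'w contract_data" and r\<^sub>I r\<^sub>J m :: real
  defines "u \<equiv> par_u P" and "v \<equiv> par_v P" and "\<delta> \<equiv> par_delta P"
    and "D \<equiv> debt P" and "a1 \<equiv> a_hat1 P r\<^sub>J" and "a2 \<equiv> a_hat2 P r\<^sub>I m"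
  assumes "standing_assumptions P"
    and "\<delta> > 0"
    and "r\<^sub>J \<ge> 0"
    and "m \<in> M_hat1 P r\<^sub>J \<inter> (\<Inter>r\<in>{0..}. M_hat2 P r)"
    and "r\<^sub>I \<ge> 0"
    and "deriv_zero (F P r\<^sub>I) > 0"
    and "B P m * exp (- u * \<delta> * psi P a2) * (exp (u * (1 + r\<^sub>J) * (D + a2)) - 1) \<in> cost_f P ` {0..}"
    and "(1 + r\<^sub>I) * (D + a2)
           \<ge> cost_inv P (B P m * exp (- u * \<delta> * psi P a2) * (exp (u * (1 + r\<^sub>J) * (D + a2)) - 1))"
    and "(1 + r\<^sub>I) * deriv (cost_f P) ((1 + r\<^sub>I) * (D + a1))
           > deriv (ben_a P) a1 + u * \<delta> * deriv (psi P) a1 * B P m * exp (- u * \<delta> * psi P a1)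
         \<or> deriv (psi P) a2 > (u + v) * (1 + r\<^sub>J) / (u * \<delta>)"
  shows "I_hat1 P r\<^sub>J m \<ge> I_hat2 P r\<^sub>I m"
proof -
  \<comment> \<open>\<open>k\<close> is the slope of \<open>psi P\<close> at \<open>a1\<close>. The
    exponent h is stationary where that slope is (1 + \<open>r\<^sub>J\<close>)/\<delta>;
    \<open>k\<close> is larger by the factor (u + v)/u, so \<open>a1\<close> lies left of the
    minimizer of h.\<close>
  define k where "k = (u + v) * (1 + r\<^sub>J) / (\<delta> * u)"
  have pos: "0 < u" "0 < v" "0 < D" "0 < B P m"
    using assms(7) by (auto simp: standing_assumptions_def B_def u_def v_def D_def)
  have psi: "C1_halfline (psi P)" "strictly_concave_on {0..} (psi P)"
    "deriv_zero (psi P) = \<infinity>" "(deriv (psi P) \<longlongrightarrow> 0) at_top"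
    using assms(7) by (auto simp: standing_assumptions_def phi_psi_ok_def)
  have psi_diff: "psi P differentiable (at x)" if "0 < x" for x
    using psi(1) that by (simp add: C1_halfline_def)
  have "0 < k" unfolding k_def using pos assms(8,9) by (intro divide_pos_pos mult_pos_pos) auto
  then have a1: "0 < a1" "deriv (psi P) a1 = k"
    using deriv_inv_works[OF psi] by (auto simp: a1_def a_hat1_def k_def u_def v_def \<delta>_def)
  \<comment> \<open>Membership in \<open>M_hat2\<close> at the rate \<open>r\<^sub>I\<close>
    supplies a maximizer, so \<open>arg_max\<close> really selects one.\<close>
  obtain a where "is_arg_max (objective2 P r\<^sub>I m) (\<lambda>a. 0 \<le> a) a"
    using assms(10,11) by (auto simp: M_hat2_def)
  then have a2: "is_arg_max (objective2 P r\<^sub>I m) (\<lambda>a. 0 \<le> a) a2"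
    unfolding a2_def a_hat2_def arg_max_def by (rule someI)
  then have "0 \<le> a2" by (simp add: is_arg_max_def)

  have "a2 \<le> a1"
  proof (rule ccontr)
    assume "\<not> a2 \<le> a1"
    then have less: "a1 < a2" by simp
    from assms(15) show False
    proof
      assume "(1 + r\<^sub>I) * deriv (cost_f P) ((1 + r\<^sub>I) * (D + a1))
        > deriv (ben_a P) a1 + u * \<delta> * deriv (psi P) a1 * B P m * exp (- u * \<delta> * psi P a1)"
      then have "objective2 P r\<^sub>I m a2 < objective2 P r\<^sub>I m a1"
        using assms(7,8,11) a1(1) less
        by (intro objective2_less_of_negative_slope) (auto simp: u_def \<delta>_def D_def)
      then show False using a2 a1(1) by (auto simp: is_arg_max_linorder dest: less_le_not_le[THEN iffD1])
    next
      assume "deriv (psi P) a2 > (u + v) * (1 + r\<^sub>J) / (u * \<delta>)"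
      then have "deriv (psi P) a1 < deriv (psi P) a2"
        by (simp add: a1(2) k_def mult.commute)
      then show False
        using strictly_concave_on_deriv_strict_antimono[OF psi(2) psi_diff a1(1) less] by simp
    qed
  qed

  let ?h = "\<lambda>a. - u * \<delta> * psi P a + u * (1 + r\<^sub>J) * (D + a)"
  \<comment> \<open>The tangent is taken at \<open>a1\<close> > 0, since \<open>a2\<close> may be 0,
    where the slope of \<open>psi P\<close> is infinite.\<close>
  have "psi P a2 \<le> psi P a1 + k * (a2 - a1)"
    using concave_on_halfline_tangent[OF strictly_concave_on_imp_concave_on[OF psi(2)]
        a1(1) \<open>0 \<le> a2\<close> psi_diff[OF a1(1)]] a1(2) by simp
  then have "u * \<delta> * (psi P a2 - psi P a1) \<le> u * \<delta> * (k * (a2 - a1))"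
    using pos assms(8) by (intro mult_left_mono) auto
  also have "\<dots> = (u + v) * (1 + r\<^sub>J) * (a2 - a1)"
    using pos assms(8) by (simp add: k_def)
  \<comment> \<open>The surplus with factor v is what remains of (u + v)(1 +
    \<open>r\<^sub>J\<close>) after the linear part of h, of slope u(1 + \<open>r\<^sub>J\<close>),
    is subtracted.\<close>
  finally have "?h a1 + v * (1 + r\<^sub>J) * (a1 - a2) \<le> ?h a2"
    by (simp add: algebra_simps)
  moreover have "0 \<le> v * (1 + r\<^sub>J) * (a1 - a2)"
    using pos assms(9) \<open>a2 \<le> a1\<close> by simp
  ultimately have "?h a1 \<le> ?h a2" by linarith
  then have "exp (?h a1) * B P m \<le> exp (?h a2) * B P m"
    using pos by simp
  moreover have "ben_a P a2 \<le> ben_a P a1"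
    using assms(7) \<open>0 \<le> a2\<close> \<open>a2 \<le> a1\<close>
    by (auto simp: standing_assumptions_def benefits_ok_def intro: mono_onD)
  ultimately have "ben_a P a2 - exp (?h a2) * B P m \<le> I_hat1 P r\<^sub>J m"
    by (simp add: I_hat1_def u_def \<delta>_def D_def a1_def exp_add[symmetric])

  \<comment> \<open>\<open>?y\<close> is the gap between the exponential terms of the two situations
    at \<open>a2\<close>. Applying the monotone cost to the condition on \<open>r\<^sub>I\<close>
    shows that the debt cost in Situation 2 is at least this gap.\<close>
  let ?y = "B P m * exp (- u * \<delta> * psi P a2) * (exp (u * (1 + r\<^sub>J) * (D + a2)) - 1)"
  have f: "mono_on {0..} (cost_f P)" "strictly_convex_on {0..} (cost_f P)"
    using assms(7) by (auto simp: standing_assumptions_def cost_ok_def)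
  note inv = cost_inv_works[OF f assms(13)]
  have "cost_f P (cost_inv P ?y) \<le> cost_f P ((1 + r\<^sub>I) * (D + a2))"
    using assms(14) inv(1) by (intro mono_onD[OF f(1)]) auto
  then have "?y \<le> cost_f P ((1 + r\<^sub>I) * (D + a2))"
    using inv(2) by simp
  moreover have "?y = exp (?h a2) * B P m - exp (- u * \<delta> * psi P a2) * B P m"
    unfolding exp_add by (simp add: algebra_simps)
  ultimately have "I_hat2 P r\<^sub>I m \<le> ben_a P a2 - exp (?h a2) * B P m"
    by (simp add: I_hat2_def objective2_def F_def u_def \<delta>_def D_def a2_def)
  also note \<open>\<dots> \<le> I_hat1 P r\<^sub>J m\<close>
  finally show ?thesis .
qed

end
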